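(* Let $f:\mathbb{Z}_n\to\mathbb{Z}_n$ be a permutation of order $m$, let $L>2$ and $J>2$, let $A_1,\dots,A_{L-1}\in\mathbb{Z}_m$ be nonzero and pairwise different, and let $i_1,\dots,i_{J-1}\in\mathbb{Z}_m$ be nonzero and pairwise different. Put $\mathcal{A}=\{0,A_1,\dots,A_{L-1}\}$, $\mathcal{I}=\{0,i_1,\dots,i_{J-1}\}$ and $$H=\begin{pmatrix}1&1&\cdots&1\\ 1&f^{A_1i_1}&\cdots&f^{A_1i_{J-1}}\\ \vdots&\vdots&\ddots&\vdots\\ 1&f^{A_{L-1}i_1}&\cdots&f^{A_{L-1}i_{J-1}}\end{pmatrix}.$$ Then $H$ contains no $4$-cycle if and only if $f^i$ is a derangement for all $i\in\mathcal{A}_\Delta\cdot\mathcal{I}_\Delta$.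
   Context: $\mathbb{Z}_n$ denotes the integers modulo $n$. A permutation $R$ of $\mathbb{Z}_n$ is identified with the $n\times n$ $0/1$ permutation matrix having entry $1$ at position $(a,c)$ iff $a=R(c)$; $1$ denotes the identity permutation (matrix). An array of permutations denotes the corresponding block matrix, here with $L$ block-rows and $J$ block-columns. Exponents of $f$ are taken modulo $m$. A derangement is a permutation without fixed points. For $\mathcal{B}\subseteq\mathbb{Z}_m$, $\mathcal{B}_\Delta=\{a-b: a,b\in\mathcal{B},\ a\ne b\}$, and $\mathcal{A}_\Delta\cdot\mathcal{I}_\Delta=\{xy: x\in\mathcal{A}_\Delta,\ y\in\mathcal{I}_\Delta\}\subseteq\mathbb{Z}_m$. Cycles: a $2k$-cycle in $H$ ($k>1$) is a closed sequence of positions $(x_0,y_0),(x_1,y_0),(x_1,y_1),\dots,(x_{k-1},y_{k-1}),(x_0,y_{k-1}),(x_0,y_0)$ of $H$, obtained by alternately changing only the row or only the column, such that all these entries of $H$ equal $1$ and the $2k$ positions (other than the repeated first/last one) are pairwise distinct. *)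

theory Defs
  imports
    "HOL-Combinatorics.Permutations"
    "Jordan_Normal_Form.Matrix"
begin

text \<open>
  The set underlying \<open>\<int>\<^sub>n\<close> is represented by the naturals \<open>{..<n}\<close> when it only serves as a set being
  permuted, and \<open>\<int>\<^sub>m\<close> by the canonical integer representatives \<open>{0..<int m}\<close> when its ring structure is
  used. A permutation of \<open>{..<n}\<close> in the sense of \<open>permutes\<close> is the identity outside \<open>{..<n}\<close>, so
  that \<open>f ^^ k = id\<close> holds on all naturals iff it holds on \<open>{..<n}\<close>.
\<close>

definition perm_order :: "(nat \<Rightarrow> nat) \<Rightarrow> nat" where
  "perm_order f = (LEAST k. 0 < k \<and> f ^^ k = id)"

definition perm_pow :: "nat \<Rightarrow> (nat \<Rightarrow> nat) \<Rightarrow> int \<Rightarrow> nat \<Rightarrow> nat" where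
  "perm_pow m f i = f ^^ nat (i mod int m)"

definition derangement :: "nat \<Rightarrow> (nat \<Rightarrow> nat) \<Rightarrow> bool" where
  "derangement n g \<longleftrightarrow> g permutes {..<n} \<and> (\<forall>x<n. g x \<noteq> x)"

definition diff_set :: "nat \<Rightarrow> int set \<Rightarrow> int set" where
  "diff_set m B = {(a - b) mod int m | a b. a \<in> B \<and> b \<in> B \<and> a \<noteq> b}"

definition mod_set_prod :: "nat \<Rightarrow> int set \<Rightarrow> int set \<Rightarrow> int set" where
  "mod_set_prod m X Y = {(x * y) mod int m | x y. x \<in> X \<and> y \<in> Y}"

definition perm_mat :: "nat \<Rightarrow> (nat \<Rightarrow> nat) \<Rightarrow> int mat" where
  "perm_mat n R = mat n n (\<lambda>(a, c). if a = R c then 1 else 0)"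

definition block_mat :: "nat \<Rightarrow> nat \<Rightarrow> nat \<Rightarrow> (nat \<Rightarrow> nat \<Rightarrow> int mat) \<Rightarrow> int mat" where
  "block_mat n L J P =
     mat (L * n) (J * n) (\<lambda>(r, c). P (r div n) (c div n) $$ (r mod n, c mod n))"

definition power_array ::
  "nat \<Rightarrow> (nat \<Rightarrow> nat) \<Rightarrow> (nat \<Rightarrow> int) \<Rightarrow> (nat \<Rightarrow> int) \<Rightarrow> nat \<Rightarrow> nat \<Rightarrow> nat \<Rightarrow> nat" where
  "power_array m f A i r c = (if r = 0 \<or> c = 0 then id else perm_pow m f (A r * i c))"

definition power_array_mat ::
  "nat \<Rightarrow> nat \<Rightarrow> nat \<Rightarrow> nat \<Rightarrow> (nat \<Rightarrow> nat) \<Rightarrow> (nat \<Rightarrow> int) \<Rightarrow> (nat \<Rightarrow> int) \<Rightarrow> int mat" where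
  "power_array_mat n m L J f A i = block_mat n L J (\<lambda>r c. perm_mat n (power_array m f A i r c))"

text \<open>
  The positions \<open>(x 0, y 0), (x 1, y 0), (x 1, y 1), \<dots>, (x (k-1), y (k-1)), (x 0, y (k-1))\<close>,
  without the final repetition of \<open>(x 0, y 0)\<close>.
\<close>

definition cycle_positions :: "nat \<Rightarrow> (nat \<Rightarrow> nat) \<Rightarrow> (nat \<Rightarrow> nat) \<Rightarrow> (nat \<times> nat) list" where
  "cycle_positions k x y = concat (map (\<lambda>j. [(x j, y j), (x (Suc j mod k), y j)]) [0..<k])"

definition has_cycle :: "int mat \<Rightarrow> nat \<Rightarrow> bool" where
  "has_cycle H l \<longleftrightarrow>
     (\<exists>k x y. k > 1 \<and> l = 2 * k \<and> distinct (cycle_positions k x y) \<and>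
        (\<forall>(r, c) \<in> set (cycle_positions k x y).
           r < dim_row H \<and> c < dim_col H \<and> H $$ (r, c) = 1))"

end

theory Submission
  imports Defs "HOL-Combinatorics.Cycles"
begin

text \<open>
  After extending \<open>A\<close> and \<open>i\<close> by \<open>0\<close> at index \<open>0\<close>, every block of \<open>H\<close> is \<open>f\<close> to the power
  \<open>A\<^sub>r i\<^sub>c\<close>. Two positions of a \<open>4\<close>-cycle cannot share a block row or block column, since a
  permutation matrix has one entry \<open>1\<close> per row and column. So a \<open>4\<close>-cycle uses block rows \<open>r \<noteq> r'\<close>
  and block columns \<open>c \<noteq> c'\<close>, and walking around it composes four powers of \<open>f\<close> to
  \<open>f\<close> to the power \<open>(A\<^sub>r - A\<^bsub>r'\<^esub>) (i\<^sub>c - i\<^bsub>c'\<^esub>)\<close>, which fixes the starting point.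
\<close>

text \<open>Finiteness of \<open>S\<close> supplies some positive exponent killing \<open>f\<close>;
  without such a witness the \<open>LEAST\<close> in \<open>perm_order\<close> would say
  nothing.\<close>

lemma perm_order_power:
  assumes "f permutes S" "finite S"
  shows "0 < perm_order f" "f ^^ perm_order f = id"
proof -
  have "permutation f"
    using assms permutation_permutes by blast
  then obtain k where "f ^^ k = id" "k > 0"
    by (rule permutation_is_nilpotent)
  hence "0 < perm_order f \<and> f ^^ perm_order f = id"
    using LeastI[of "\<lambda>k. 0 < k \<and> f ^^ k = id" k] by (simp add: perm_order_def)
  thus "0 < perm_order f" "f ^^ perm_order f = id" by simp_all
qed

lemma perm_pow_mod [simp]: "perm_pow m f (x mod int m) = perm_pow m f x"
  by (simp add: perm_pow_def)

lemma perm_pow_0 [simp]: "perm_pow m f 0 = id"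
  by (simp add: perm_pow_def)

text \<open>Reducing exponents to \<open>{0..<m}\<close> may drop a multiple of \<open>m\<close>
  from the sum, which \<open>f ^^ m = id\<close> absorbs. Negative exponents thus act as
  inverses.\<close>

lemma perm_pow_add:
  assumes "0 < m" "f ^^ m = id"
  shows "perm_pow m f (a + b) x = perm_pow m f a (perm_pow m f b x)"
proof -
  have "(f ^^ m) y = y" for y using assms by simp
  note mod_eq = funpow_mod_eq[OF this]
  have "(a + b) mod int m = (a mod int m + b mod int m) mod int m"
    by (simp only: mod_add_eq)
  also have "\<dots> = int ((nat (a mod int m) + nat (b mod int m)) mod m)"
    using assms(1) by (simp only: zmod_int of_nat_add) simp
  finally have "nat ((a + b) mod int m) = (nat (a mod int m) + nat (b mod int m)) mod m"
    by (simp only: nat_int)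
  thus ?thesis
    by (simp only: perm_pow_def mod_eq funpow_add o_apply)
qed

lemma perm_pow_permutes:
  assumes "f permutes S"
  shows "perm_pow m f a permutes S"
  unfolding perm_pow_def by (rule permutes_funpow[OF assms])

text \<open>Here \<open>u\<close>, \<open>u'\<close> are row offsets and \<open>v\<close>,
  \<open>v'\<close> column offsets inside blocks; the four equations say that the four corner
  entries are 1. Eliminating all but \<open>u\<close> leaves the fixed point equation.\<close>

lemma rectangle_iff_fixed_point:
  fixes a a' c c' :: int
  assumes "f permutes S" "0 < m" "f ^^ m = id"
  shows "(\<exists>u\<in>S. \<exists>u'\<in>S. \<exists>v\<in>S. \<exists>v'\<in>S.
      u = perm_pow m f (a * c) v \<and> u' = perm_pow m f (a' * c) v \<and>
      u' = perm_pow m f (a' * c') v' \<and> u = perm_pow m f (a * c') v') \<longleftrightarrow>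
    (\<exists>z\<in>S. perm_pow m f ((a - a') * (c - c')) z = z)" (is "?lhs \<longleftrightarrow> ?rhs")
proof
  note add = perm_pow_add[OF assms(2,3)]
  have inv: "perm_pow m f (- e) (perm_pow m f e z) = z" for e z
    using add[of "- e" e z] by simp
  show ?rhs if ?lhs
  proof -
    from that obtain u u' v v' where "u \<in> S"
      and u: "u = perm_pow m f (a * c) v" and u': "u' = perm_pow m f (a' * c) v"
      and w': "u' = perm_pow m f (a' * c') v'" and w: "u = perm_pow m f (a * c') v'"
      by blast
    \<comment> \<open>Read from right to left, the summands carry \<open>u\<close> to
      \<open>v'\<close>, \<open>u'\<close>, \<open>v\<close> and back to \<open>u\<close>.\<close>
    have "(a - a') * (c - c') = a * c + (- (a' * c) + (a' * c' + - (a * c')))"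
      by (simp add: algebra_simps)
    hence "perm_pow m f ((a - a') * (c - c')) u =
        perm_pow m f (a * c) (perm_pow m f (- (a' * c))
          (perm_pow m f (a' * c') (perm_pow m f (- (a * c')) u)))"
      by (simp only: add)
    also have "\<dots> = u"
      using inv[of "a * c'" v'] inv[of "a' * c" v] u u' w w' by metis
    finally show ?thesis using \<open>u \<in> S\<close> by blast
  qed
  show ?lhs if ?rhs
  proof -
    from that obtain z where "z \<in> S" and z: "perm_pow m f ((a - a') * (c - c')) z = z"
      by blast
    \<comment> \<open>With \<open>u = z\<close>, the column offsets are forced to be preimages of
      \<open>z\<close>; it remains to see that both give the same \<open>u'\<close>.\<close>
    let ?v = "perm_pow m f (- (a * c)) z" and ?v' = "perm_pow m f (- (a * c')) z"
    have mem: "perm_pow m f e x \<in> S" if "x \<in> S" for e x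
      using permutes_in_image[OF perm_pow_permutes[OF assms(1)]] that by blast
    \<comment> \<open>Replacing \<open>z\<close> by its image under the fixing power shifts the
      exponent \<open>a' * c - a * c\<close> to \<open>a' * c' - a * c'\<close>.\<close>
    have "perm_pow m f (a' * c) ?v =
        perm_pow m f (a' * c + - (a * c)) (perm_pow m f ((a - a') * (c - c')) z)"
      by (simp only: add z)
    also have "\<dots> = perm_pow m f (a' * c' + - (a * c')) z"
      by (subst add[symmetric], rule arg_cong[where f = "\<lambda>e. perm_pow m f e z"])
        (simp add: algebra_simps)
    also have "\<dots> = perm_pow m f (a' * c') ?v'"
      by (simp only: add)
    finally have *: "perm_pow m f (a' * c) ?v = perm_pow m f (a' * c') ?v'" .
    have "z = perm_pow m f (a * c) ?v" "z = perm_pow m f (a * c') ?v'"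
      by (simp_all flip: add)
    with * mem \<open>z \<in> S\<close> show ?thesis by blast
  qed
qed

text \<open>Length 4 forces \<open>k = 2\<close>. Consecutive positions share a row or a column, so
  their distinctness separates the two columns or the two rows.\<close>

lemma has_cycle_4_iff:
  "has_cycle H 4 \<longleftrightarrow> (\<exists>x x' y y'. x \<noteq> x' \<and> y \<noteq> y' \<and>
     x < dim_row H \<and> x' < dim_row H \<and> y < dim_col H \<and> y' < dim_col H \<and>
     H $$ (x, y) = 1 \<and> H $$ (x', y) = 1 \<and> H $$ (x', y') = 1 \<and> H $$ (x, y') = 1)"
    (is "_ \<longleftrightarrow> ?rhs")
proof -
  have pos: "cycle_positions 2 x y = [(x 0, y 0), (x 1, y 0), (x 1, y 1), (x 0, y 1)]" for x y
    by (simp add: cycle_positions_def numeral_2_eq_2)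
  have two: "1 < k \<and> 4 = 2 * k \<longleftrightarrow> k = 2" for k :: nat by auto
  have "has_cycle H 4 \<longleftrightarrow> (\<exists>x y. distinct (cycle_positions 2 x y) \<and>
     (\<forall>(r, c) \<in> set (cycle_positions 2 x y). r < dim_row H \<and> c < dim_col H \<and> H $$ (r, c) = 1))"
    unfolding has_cycle_def conj_assoc[symmetric] two by blast
  also have "\<dots> \<longleftrightarrow> ?rhs"
    unfolding pos
  proof
    assume ?rhs
    then obtain x x' y y' where h: "x \<noteq> x'" "y \<noteq> y'"
      "x < dim_row H" "x' < dim_row H" "y < dim_col H" "y' < dim_col H"
      "H $$ (x, y) = 1" "H $$ (x', y) = 1" "H $$ (x', y') = 1" "H $$ (x, y') = 1" by blast
    \<comment> \<open>Only the values at 0 and 1 enter \<open>cycle_positions 2\<close>.\<close>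
    let ?x = "\<lambda>j. if j = (0::nat) then x else x'" and ?y = "\<lambda>j. if j = (0::nat) then y else y'"
    show "\<exists>x y. distinct [(x 0, y 0), (x 1, y 0), (x 1, y 1), (x 0, y 1)] \<and>
       (\<forall>(r, c) \<in> set [(x (0::nat), y (0::nat)), (x 1, y 0), (x 1, y 1), (x 0, y 1)].
         r < dim_row H \<and> c < dim_col H \<and> H $$ (r, c) = 1)"
      by (rule exI[of _ ?x], rule exI[of _ ?y]) (use h in simp)
  next
    assume "\<exists>x y. distinct [(x 0, y 0), (x 1, y 0), (x 1, y 1), (x 0, y 1)] \<and>
       (\<forall>(r, c) \<in> set [(x (0::nat), y (0::nat)), (x 1, y 0), (x 1, y 1), (x 0, y 1)].
         r < dim_row H \<and> c < dim_col H \<and> H $$ (r, c) = 1)"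
    then obtain x y :: "nat \<Rightarrow> nat"
      where d: "distinct [(x 0, y 0), (x 1, y 0), (x 1, y 1), (x 0, y 1)]"
      and e: "\<forall>(r, c) \<in> set [(x 0, y 0), (x 1, y 0), (x 1, y 1), (x 0, y 1)].
         r < dim_row H \<and> c < dim_col H \<and> H $$ (r, c) = 1" by blast
    have "x 0 \<noteq> x 1" "y 0 \<noteq> y 1" using d by auto
    moreover have "x 0 < dim_row H" "x 1 < dim_row H" "y 0 < dim_col H" "y 1 < dim_col H"
      "H $$ (x 0, y 0) = 1" "H $$ (x 1, y 0) = 1" "H $$ (x 1, y 1) = 1" "H $$ (x 0, y 1) = 1"
      using e by simp_all
    ultimately show ?rhs by blast
  qed
  finally show ?thesis .
qed

lemma block_mat_perm_mat_index:
  assumes "r < L" "c < J" "a < n" "b < n"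
  shows "block_mat n L J (\<lambda>r c. perm_mat n (P r c)) $$ (r * n + a, c * n + b) =
    (if a = P r c b then 1 else 0)"
proof -
  have "k * n + d < K * n" if "k < K" "d < n" for k d K
  proof -
    have "k * n + d < Suc k * n" using that by simp
    also have "\<dots> \<le> K * n" using that by (intro mult_right_mono) auto
    finally show ?thesis .
  qed
  with assms show ?thesis by (simp add: block_mat_def perm_mat_def)
qed

lemma less_mult_iff_ex:
  fixes x :: nat
  assumes "0 < n"
  shows "x < L * n \<longleftrightarrow> (\<exists>r<L. \<exists>a<n. x = r * n + a)"
proof
  assume "x < L * n"
  hence "x div n < L" "x mod n < n" "x = x div n * n + x mod n"
    using assms by (auto simp: less_mult_imp_div_less)
  thus "\<exists>r<L. \<exists>a<n. x = r * n + a" by blast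
next
  assume "\<exists>r<L. \<exists>a<n. x = r * n + a"
  then obtain r a where "r < L" "a < n" "x = r * n + a" by blast
  hence "x < Suc r * n" by simp
  also have "\<dots> \<le> L * n" using \<open>r < L\<close> by (intro mult_right_mono) auto
  finally show "x < L * n" .
qed

text \<open>Global indices split into block number and offset. Distinctness passes from global
  indices to block numbers because each block has a single 1 in every row and column.\<close>

lemma has_cycle_4_block_mat_iff:
  assumes "0 < n" and perm: "\<And>r c. r < L \<Longrightarrow> c < J \<Longrightarrow> P r c permutes {..<n}"
  shows "has_cycle (block_mat n L J (\<lambda>r c. perm_mat n (P r c))) 4 \<longleftrightarrow>
    (\<exists>r<L. \<exists>r'<L. \<exists>c<J. \<exists>c'<J. r \<noteq> r' \<and> c \<noteq> c' \<and>
      (\<exists>u\<in>{..<n}. \<exists>u'\<in>{..<n}. \<exists>v\<in>{..<n}. \<exists>v'\<in>{..<n}.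
        u = P r c v \<and> u' = P r' c v \<and> u' = P r' c' v' \<and> u = P r c' v'))"
    (is "has_cycle ?H 4 \<longleftrightarrow> ?rhs")
proof
  have dim: "dim_row ?H = L * n" "dim_col ?H = J * n" by (simp_all add: block_mat_def)
  note entry = block_mat_perm_mat_index[of _ L _ J _ n]
  show ?rhs if "has_cycle ?H 4"
  proof -
    from that obtain x x' y y' where "x \<noteq> x'" "y \<noteq> y'"
      and "x < L * n" "x' < L * n" "y < J * n" "y' < J * n"
      and one: "?H $$ (x, y) = 1" "?H $$ (x', y) = 1" "?H $$ (x', y') = 1" "?H $$ (x, y') = 1"
      unfolding has_cycle_4_iff dim by blast
    then obtain r a r' a' c b c' b' where
      x: "r < L" "a < n" "x = r * n + a" and x': "r' < L" "a' < n" "x' = r' * n + a'" and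
      y: "c < J" "b < n" "y = c * n + b" and y': "c' < J" "b' < n" "y' = c' * n + b'"
      unfolding less_mult_iff_ex[OF \<open>0 < n\<close>] by blast
    have eqs: "a = P r c b" "a' = P r' c b" "a' = P r' c' b'" "a = P r c' b'"
      using one x x' y y' by (simp_all add: entry split: if_splits)
    \<comment> \<open>In a common block row, \<open>a\<close> and \<open>a'\<close> would both be
      the image of \<open>b\<close> under \<open>P r c\<close>.\<close>
    have "r \<noteq> r'" using eqs \<open>x \<noteq> x'\<close> x x' by auto
    \<comment> \<open>In a common block column, \<open>b\<close> and \<open>b'\<close> would have
      the same image \<open>a\<close>, so injectivity of \<open>P r c\<close> would identify
      them.\<close>
    moreover have "c \<noteq> c'"
      using eqs \<open>y \<noteq> y'\<close> y y' permutes_inj[OF perm, of r c] x by (auto dest: injD)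
    ultimately show ?thesis using eqs x x' y y' by blast
  qed
  show "has_cycle ?H 4" if ?rhs
  proof -
    from that obtain r r' c c' u u' v v' where
      h: "r < L" "r' < L" "c < J" "c' < J" "r \<noteq> r'" "c \<noteq> c'" "u < n" "u' < n" "v < n" "v' < n"
      and eqs: "u = P r c v" "u' = P r' c v" "u' = P r' c' v'" "u = P r c' v'"
      by blast
    have ne: "k * n + d \<noteq> k' * n + d'" if "k \<noteq> k'" "d < n" "d' < n" for k k' d d' :: nat
    proof
      assume "k * n + d = k' * n + d'"
      hence "(k * n + d) div n = (k' * n + d') div n" by simp
      with that show False by simp
    qed
    have lt: "k * n + d < K * n" if "k < K" "d < n" for k d K
      using that less_mult_iff_ex[OF \<open>0 < n\<close>] by blast
    show ?thesis
      unfolding has_cycle_4_iff dim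
      by (rule exI[of _ "r * n + u"], rule exI[of _ "r' * n + u'"],
          rule exI[of _ "c * n + v"], rule exI[of _ "c' * n + v'"])
        (use h in \<open>simp add: entry ne lt eqs(1)[symmetric] eqs(2)[symmetric]
           eqs(3)[symmetric] eqs(4)[symmetric]\<close>)
  qed
qed

theorem theorem7:
  fixes n m L J :: nat and f :: "nat \<Rightarrow> nat" and A i :: "nat \<Rightarrow> int"
  assumes "n > 0"
    and "f permutes {..<n}" and "perm_order f = m"
    and "L > 2" and "J > 2"
    and "\<forall>r\<in>{1..<L}. A r \<in> {0..<int m} \<and> A r \<noteq> 0" and "inj_on A {1..<L}"
    and "\<forall>c\<in>{1..<J}. i c \<in> {0..<int m} \<and> i c \<noteq> 0" and "inj_on i {1..<J}"
  defines "\<A> \<equiv> insert 0 (A ` {1..<L})" and "\<I> \<equiv> insert 0 (i ` {1..<J})"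
  shows "\<not> has_cycle (power_array_mat n m L J f A i) 4 \<longleftrightarrow>
    (\<forall>e \<in> mod_set_prod m (diff_set m \<A>) (diff_set m \<I>). derangement n (perm_pow m f e))"
proof -
  \<comment> \<open>\<open>A 0\<close> and \<open>i 0\<close> are arbitrary; overriding them by 0
    turns the border of identity blocks into powers with exponent 0.\<close>
  define B where "B = A(0 := 0)"
  define D where "D = i(0 := 0)"
  have perm: "perm_pow m f e permutes {..<n}" for e
    by (rule perm_pow_permutes[OF assms(2)])
  have m: "0 < m" "f ^^ m = id"
    using perm_order_power[OF assms(2)] assms(3) by auto
  have array: "power_array m f A i = (\<lambda>r c. perm_pow m f (B r * D c))"
    by (auto simp: power_array_def B_def D_def fun_eq_iff)
  have range: "{..<L} = insert 0 {1..<L}" "{..<J} = insert 0 {1..<J}"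
    using assms(4,5) by auto
  \<comment> \<open>The added value 0 is new because the other values are nonzero.\<close>
  have inj: "inj_on B {..<L}" "inj_on D {..<J}"
    using assms(6-9) by (auto simp: inj_on_def B_def D_def)
  have img: "\<A> = B ` {..<L}" "\<I> = D ` {..<J}"
    unfolding \<A>_def \<I>_def range by (auto simp: B_def D_def)
  have "has_cycle (power_array_mat n m L J f A i) 4 \<longleftrightarrow>
      (\<exists>r<L. \<exists>r'<L. \<exists>c<J. \<exists>c'<J. r \<noteq> r' \<and> c \<noteq> c' \<and>
        (\<exists>z<n. perm_pow m f ((B r - B r') * (D c - D c')) z = z))"
    unfolding power_array_mat_def array
    by (subst has_cycle_4_block_mat_iff[OF assms(1) perm])
      (unfold rectangle_iff_fixed_point[OF assms(2) m], simp only: Bex_def lessThan_iff)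
  also have "\<dots> \<longleftrightarrow> (\<exists>a\<in>\<A>. \<exists>a'\<in>\<A>. \<exists>c\<in>\<I>. \<exists>c'\<in>\<I>. a \<noteq> a' \<and> c \<noteq> c' \<and>
        (\<exists>z<n. perm_pow m f ((a - a') * (c - c')) z = z))"
  proof -
    have "B r = B r' \<longleftrightarrow> r = r'" if "r < L" "r' < L" for r r'
      using inj_on_eq_iff[OF inj(1)] that by simp
    moreover have "D c = D c' \<longleftrightarrow> c = c'" if "c < J" "c' < J" for c c'
      using inj_on_eq_iff[OF inj(2)] that by simp
    ultimately show ?thesis
      unfolding img by (simp add: Bex_def cong: conj_cong) blast
  qed
  also have "\<dots> \<longleftrightarrow> (\<exists>e \<in> mod_set_prod m (diff_set m \<A>) (diff_set m \<I>).
      \<exists>z<n. perm_pow m f e z = z)"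
  proof -
    \<comment> \<open>Reducing the two differences before multiplying does not change the product
      modulo \<open>m\<close>, so the product set consists of the reduced rectangle
      exponents.\<close>
    have "mod_set_prod m (diff_set m \<A>) (diff_set m \<I>) =
      {((a - a') * (c - c')) mod int m | a a' c c'.
         a \<in> \<A> \<and> a' \<in> \<A> \<and> c \<in> \<I> \<and> c' \<in> \<I> \<and> a \<noteq> a' \<and> c \<noteq> c'}"
      (is "?X = ?Y")
    proof
      show "?X \<subseteq> ?Y"
      proof
        fix e assume "e \<in> ?X"
        then obtain a a' c c' where "e = ((a - a') mod int m * ((c - c') mod int m)) mod int m"
          and h: "a \<in> \<A>" "a' \<in> \<A>" "c \<in> \<I>" "c' \<in> \<I>" "a \<noteq> a'" "c \<noteq> c'"
          unfolding mod_set_prod_def diff_set_def by blast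
        hence "e = ((a - a') * (c - c')) mod int m"
          by (simp only: mod_mult_eq)
        with h show "e \<in> ?Y" by blast
      qed
      show "?Y \<subseteq> ?X"
      proof
        fix e assume "e \<in> ?Y"
        then obtain a a' c c' where "e = ((a - a') * (c - c')) mod int m"
          and h: "a \<in> \<A>" "a' \<in> \<A>" "c \<in> \<I>" "c' \<in> \<I>" "a \<noteq> a'" "c \<noteq> c'" by blast
        hence "e = ((a - a') mod int m * ((c - c') mod int m)) mod int m"
          by (simp only: mod_mult_eq)
        with h show "e \<in> ?X"
          unfolding mod_set_prod_def diff_set_def by blast
      qed
    qed
    have "(\<exists>e \<in> ?Y. Q e) \<longleftrightarrow> (\<exists>a\<in>\<A>. \<exists>a'\<in>\<A>. \<exists>c\<in>\<I>. \<exists>c'\<in>\<I>. a \<noteq> a' \<and> c \<noteq> c' \<and>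
        Q (((a - a') * (c - c')) mod int m))" for Q
      by blast
    from this[of "\<lambda>e. \<exists>z<n. perm_pow m f e z = z"] show ?thesis
      unfolding \<open>?X = ?Y\<close> perm_pow_mod by (rule sym)
  qed
  \<comment> \<open>Since \<open>perm\<close> makes every power a permutation, failing to be a
    derangement means having a fixed point.\<close>
  finally show ?thesis
    by (simp add: derangement_def perm)
qed

end
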